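(* Let $p$ be a prime and $K$ a finite extension of $\mathbb{Q}_p$ with maximal ideal $\mathfrak{p}$ of $\mathcal{O}_K$, uniformizer $\pi$, and ramification index $e$. Let $x_0 \in K$ be the primitive anti-partial derivative of $D_{K,\mathfrak{p}}(x_0)$, with $\nu_{\mathfrak{p}}(x_0) = b_0p^{k_0}$ where $b_0\in\mathbb{Q}$, $\nu_p(b_0) = 0$ and $k_0 > 0$ an integer. Let \[C(x_0) := \{c \in \mathbb{Z}_{\geq 0} : \nu_p(b_0-c) = p^{k_0}c\}.\] Then there is a one-to-one correspondence between $C(x_0)$ and the set of all anti-partial derivatives of $D_{K,\mathfrak{p}}(x_0)$ in $K$. Furthermore, write $x_0 = \alpha_0\pi^{eb_0p^{k_0}}$ and $p = \alpha_p \pi^e$ with $\alpha_0, \alpha_p \in \mathcal{O}_K^{\times}$. If $x = \alpha\pi^{ebp^{k}}$ is an anti-partial derivative of $D_{K,\mathfrak{p}}(x_0)$ with $\nu_p(b) = 0$ and $\alpha \in \mathcal{O}_K^{\times}$, then there exists a unique $c \in C(x_0)$ such that \[k = p^{k_0}c+k_0 \in \mathbb{Z}_{\geq 0}, \quad b = \frac{b_0-c}{p^{k-k_0}} = \frac{b_0-c}{p^{p^{k_0}c}}, \quad \alpha = \dfrac{\alpha_0b_0}{b}\alpha_p^{k_0-k} \in \mathcal{O}_K^{\times}.\]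
   Context: $\nu_{\mathfrak{p}}$ is the unique discrete valuation on $K$ extending $\nu_p$ (so $\nu_{\mathfrak{p}}(p)=1$, $\nu_{\mathfrak{p}}(\pi)=1/e$). $D_{K,\mathfrak{p}}(x) = x\,\nu_{\mathfrak{p}}(x)/p$ for $x\neq 0$, $D_{K,\mathfrak{p}}(0)=0$. An anti-partial derivative of $y \in K$ is an $x\in K$ with $D_{K,\mathfrak{p}}(x)=y$. For $x$ with $\nu_{\mathfrak{p}}(x)\notin\{0,+\infty\}$ write $\nu_{\mathfrak{p}}(x)=bp^k$ with $b\in\mathbb{Q}$, $\nu_p(b)=0$, $k\in\mathbb{Z}$. An element $x_0$ is the primitive anti-partial derivative of $y$ if it is an anti-partial derivative of $y$ whose exponent $k_0$ is the smallest among the exponents $k$ of all anti-partial derivatives of $y$. *)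

theory Defs
  imports
    "Berlekamp_Zassenhaus.Finite_Field"
    "HOL-Computational_Algebra.Fraction_Field"
    "HOL-Computational_Algebra.Group_Closure"
    "HOL-Library.Extended"
begin

section \<open>The field of p-adic numbers\<close>

text \<open>
  The prime is \<^term>\<open>CARD('p)\<close> for a type \<^typ>\<open>'p\<close> of class \<^class>\<open>prime_card\<close>.
  The ring of p-adic integers is the inverse limit of the rings of residues modulo \<open>p ^ n\<close>:
  the \<open>n\<close>-th entry of a coherent sequence is the representative in \<open>{0..<p ^ n}\<close>.
\<close>

typedef ('p :: prime_card) padic_int =
  "{x :: nat \<Rightarrow> int. \<forall>n. x n \<in> {0..<int CARD('p) ^ n} \<and> x (Suc n) mod int CARD('p) ^ n = x n}"
  morphisms residue Abs_padic_int
  by (rule exI[of _ "\<lambda>_. 0"]) (simp add: prime_card prime_gt_0_nat)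

setup_lifting type_definition_padic_int

lemma CARD_prime_pos: "0 < int CARD('p :: prime_card)"
  using prime_gt_0_nat[OF prime_card[where ?'a = 'p]] by simp

lemma coherent_mod:
  fixes a a' :: int
  assumes "a' mod int CARD('p :: prime_card) ^ n = a mod int CARD('p) ^ n"
  shows "a mod int CARD('p) ^ n \<in> {0..<int CARD('p) ^ n} \<and>
           (a' mod int CARD('p) ^ Suc n) mod int CARD('p) ^ n = a mod int CARD('p) ^ n"
proof -
  have "(a' mod int CARD('p) ^ Suc n) mod int CARD('p) ^ n = a' mod int CARD('p) ^ n"
    by (rule mod_mod_cancel) simp
  then show ?thesis
    using assms CARD_prime_pos[where ?'p = 'p] by simp
qed

instantiation padic_int :: (prime_card) comm_ring_1
begin

lift_definition zero_padic_int :: "'a padic_int" is "\<lambda>n. 0 mod int CARD('a) ^ n"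
  by (rule coherent_mod) simp

lift_definition one_padic_int :: "'a padic_int" is "\<lambda>n. 1 mod int CARD('a) ^ n"
  by (rule coherent_mod) simp

lift_definition plus_padic_int :: "'a padic_int \<Rightarrow> 'a padic_int \<Rightarrow> 'a padic_int"
  is "\<lambda>x y n. (x n + y n) mod int CARD('a) ^ n"
  by (rule coherent_mod) (metis mod_add_eq mod_mod_trivial)

lift_definition times_padic_int :: "'a padic_int \<Rightarrow> 'a padic_int \<Rightarrow> 'a padic_int"
  is "\<lambda>x y n. (x n * y n) mod int CARD('a) ^ n"
  by (rule coherent_mod) (metis mod_mult_eq mod_mod_trivial)

lift_definition uminus_padic_int :: "'a padic_int \<Rightarrow> 'a padic_int"
  is "\<lambda>x n. (- x n) mod int CARD('a) ^ n"
  by (rule coherent_mod) (metis mod_minus_eq mod_mod_trivial)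

lift_definition minus_padic_int :: "'a padic_int \<Rightarrow> 'a padic_int \<Rightarrow> 'a padic_int"
  is "\<lambda>x y n. (x n - y n) mod int CARD('a) ^ n"
  by (rule coherent_mod) (metis mod_diff_eq mod_mod_trivial)

instance
proof
  fix a b c :: "'a padic_int"
  show "a + b + c = a + (b + c)" by transfer (simp add: mod_simps add.assoc)
  show "a + b = b + a" by transfer (simp add: add.commute)
  show "0 + a = a" by transfer (force simp: fun_eq_iff)
  show "- a + a = 0" by transfer (simp add: mod_simps)
  show "a - b = a + - b" by transfer (simp add: mod_simps)
  show "a * b * c = a * (b * c)" by transfer (simp add: mod_simps mult.assoc)
  show "a * b = b * a" by transfer (simp add: mult.commute)
  show "1 * a = a" by transfer (force simp: fun_eq_iff mod_simps)
  show "(a + b) * c = a * c + b * c" by transfer (simp add: mod_simps distrib_right)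
  show "(0 :: 'a padic_int) \<noteq> 1"
  proof (transfer, rule notI)
    assume "(\<lambda>n. 0 mod int CARD('a) ^ n) = (\<lambda>n. 1 mod int CARD('a) ^ n)"
    then have "(0::int) mod int CARD('a) ^ 1 = 1 mod int CARD('a) ^ 1" by (rule fun_cong)
    moreover have "1 < int CARD('a)"
      using prime_gt_1_nat[OF prime_card[where ?'a = 'a]] by simp
    ultimately show False by simp
  qed
qed

end

lemma residue_mod: "residue x n mod int CARD('p) ^ n = residue x n" for x :: "'p :: prime_card padic_int"
  using residue[of x] by simp

lemma residue_less: "0 \<le> residue x n" "residue x n < int CARD('p) ^ n"
  for x :: "'p :: prime_card padic_int"
  using residue[of x] by auto

lemma residue_mod_le:
  "residue x (n + k) mod int CARD('p) ^ n = residue x n" for x :: "'p :: prime_card padic_int"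
proof (induction k)
  case 0 show ?case by (simp add: residue_mod)
next
  case (Suc k)
  have "residue x (n + k) = residue x (Suc (n + k)) mod int CARD('p) ^ (n + k)"
    using residue[of x] by simp
  then have "residue x (n + k) mod int CARD('p) ^ n = residue x (n + Suc k) mod int CARD('p) ^ n"
    by (simp add: mod_mod_cancel le_imp_power_dvd)
  with Suc show ?case by simp
qed

lemma residue_of_nat:
  "residue (of_nat m :: 'p :: prime_card padic_int) n = int m mod int CARD('p) ^ n"
  by (induction m) (simp_all add: zero_padic_int.rep_eq plus_padic_int.rep_eq one_padic_int.rep_eq mod_simps)

lemma residue_p_power:
  "residue (of_nat CARD('p) ^ m :: 'p :: prime_card padic_int) n = int CARD('p) ^ m mod int CARD('p) ^ n"
  using residue_of_nat[where ?'p = 'p, of "CARD('p) ^ m" n] by simp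

lemma p_power_dvd_iff:
  "(of_nat CARD('p) :: 'p padic_int) ^ n dvd x \<longleftrightarrow> residue x n = 0"
  for x :: "'p :: prime_card padic_int"
proof
  assume "of_nat CARD('p) ^ n dvd x"
  then obtain y where "x = of_nat CARD('p) ^ n * y" by (auto elim: dvdE)
  then show "residue x n = 0"
    by (simp add: times_padic_int.rep_eq residue_p_power)
next
  let ?p = "int CARD('p)"
  assume x: "residue x n = 0"
  have dvd: "?p ^ n dvd residue x (n + k)" for k
    using residue_mod_le[of x n k] x by (simp add: dvd_eq_mod_eq_0)
  define y where "y k = residue x (n + k) div ?p ^ n" for k
  have xy: "residue x (n + k) = ?p ^ n * y k" for k
    using dvd[of k] by (simp add: y_def)
  have pos: "0 < ?p ^ n" for n using CARD_prime_pos[where ?'p = 'p] by simp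
  have coh: "\<forall>k. y k \<in> {0..<?p ^ k} \<and> y (Suc k) mod ?p ^ k = y k"
  proof
    fix k
    have "0 \<le> y k" using residue_less(1)[of x "n + k"] pos[of n] by (simp add: y_def pos_imp_zdiv_nonneg_iff)
    moreover have "?p ^ n * y k < ?p ^ n * ?p ^ k"
      using residue_less(2)[of x "n + k"] by (simp add: xy power_add)
    then have "y k < ?p ^ k" using pos[of n] by simp
    moreover have "residue x (n + Suc k) mod ?p ^ (n + k) = residue x (n + k)"
      using residue_mod_le[of x "n + k" 1] by simp
    then have "?p ^ n * (y (Suc k) mod ?p ^ k) = ?p ^ n * y k"
      by (simp only: xy power_add mult_mod_right)
    then have "y (Suc k) mod ?p ^ k = y k" using pos[of n] by simp
    ultimately show "y k \<in> {0..<?p ^ k} \<and> y (Suc k) mod ?p ^ k = y k" by simp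
  qed
  then have r: "residue (Abs_padic_int y :: 'p padic_int) = y"
    by (intro Abs_padic_int_inverse) blast
  have "x = of_nat CARD('p) ^ n * Abs_padic_int y"
  proof (rule iffD1[OF residue_inject], rule ext)
    fix k
    have "residue x k = residue x (k + n) mod ?p ^ k" by (simp add: residue_mod_le)
    also have "\<dots> = (?p ^ n * y k) mod ?p ^ k" using xy[of k] by (simp add: add.commute)
    finally show "residue x k = residue (of_nat CARD('p) ^ n * Abs_padic_int y :: 'p padic_int) k"
      by (simp add: times_padic_int.rep_eq residue_p_power r mod_simps)
  qed
  then show "of_nat CARD('p) ^ n dvd x" by simp
qed

definition padic_int_val :: "'p :: prime_card padic_int \<Rightarrow> nat" where
  "padic_int_val x = (GREATEST n. of_nat CARD('p) ^ n dvd x)"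

lemma padic_int_eq_0_iff: "x = 0 \<longleftrightarrow> (\<forall>n. residue x n = 0)" for x :: "'p :: prime_card padic_int"
  by (simp add: residue_inject[symmetric] zero_padic_int.rep_eq fun_eq_iff)

lemma residue_eq_0_iff:
  fixes x :: "'p :: prime_card padic_int"
  assumes "x \<noteq> 0"
  shows "residue x n = 0 \<longleftrightarrow> n \<le> padic_int_val x"
proof -
  let ?P = "\<lambda>n. (of_nat CARD('p) :: 'p padic_int) ^ n dvd x"
  have down: "?P m" if "?P n" "m \<le> n" for m n
    using that by (meson dvd_trans le_imp_power_dvd)
  obtain N where N: "\<not> ?P N" using assms by (auto simp: padic_int_eq_0_iff p_power_dvd_iff)
  then have b: "\<And>n. ?P n \<Longrightarrow> n \<le> N" using down nat_le_linear by blast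
  have "?P (padic_int_val x)" unfolding padic_int_val_def
    by (rule GreatestI_nat[of ?P 0 N]) (use b in auto)
  moreover have "n \<le> padic_int_val x" if "?P n" for n unfolding padic_int_val_def
    by (rule Greatest_le_nat[of ?P n N]) (use b that in auto)
  ultimately show ?thesis unfolding p_power_dvd_iff[symmetric] using down by blast
qed

lemma residue_multiplicity:
  fixes x :: "'p :: prime_card padic_int"
  assumes "x \<noteq> 0" "n > padic_int_val x"
  shows "multiplicity (int CARD('p)) (residue x n) = padic_int_val x"
    and "residue x n \<noteq> 0"
proof -
  let ?v = "padic_int_val x"
  have d: "int CARD('p) ^ m dvd residue x n \<longleftrightarrow> residue x m = 0" if "m \<le> n" for m
    using residue_mod_le[of x m "n - m"] that by (simp add: dvd_eq_mod_eq_0)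
  show "multiplicity (int CARD('p)) (residue x n) = ?v"
    by (rule multiplicity_eqI)
      (use d[of ?v] d[of "Suc ?v"] assms in \<open>auto simp: residue_eq_0_iff\<close>)
  show "residue x n \<noteq> 0" using assms by (simp add: residue_eq_0_iff)
qed

lemma padic_int_mult_residue:
  fixes x y :: "'p :: prime_card padic_int"
  assumes "x \<noteq> 0" "y \<noteq> 0"
  shows "residue (x * y) n = 0 \<longleftrightarrow> n \<le> padic_int_val x + padic_int_val y"
proof -
  let ?p = "int CARD('p)"
  let ?N = "n + padic_int_val x + padic_int_val y + 1"
  note x = residue_multiplicity[OF assms(1), of ?N] and y = residue_multiplicity[OF assms(2), of ?N]
  have p: "prime ?p" using prime_card[where ?'a = 'p] by simp
  have "residue (x * y) n = residue (x * y) ?N mod ?p ^ n"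
    using residue_mod_le[of "x * y" n "padic_int_val x + padic_int_val y + 1"] by (simp add: add.assoc)
  also have "\<dots> = (residue x ?N * residue y ?N) mod ?p ^ n"
    by (simp only: times_padic_int.rep_eq) (rule mod_mod_cancel, simp add: le_imp_power_dvd)
  finally have "residue (x * y) n = 0 \<longleftrightarrow> ?p ^ n dvd residue x ?N * residue y ?N"
    by (simp add: dvd_eq_mod_eq_0)
  also have "\<dots> \<longleftrightarrow> n \<le> multiplicity ?p (residue x ?N * residue y ?N)"
    using x y p by (intro power_dvd_iff_le_multiplicity) auto
  also have "multiplicity ?p (residue x ?N * residue y ?N) = padic_int_val x + padic_int_val y"
    using x y p by (subst prime_elem_multiplicity_mult_distrib) auto
  finally show ?thesis .
qed

instance padic_int :: (prime_card) idom
proof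
  fix x y :: "'a padic_int"
  assume "x \<noteq> 0" "y \<noteq> 0"
  from padic_int_mult_residue[OF this, of "Suc (padic_int_val x + padic_int_val y)"]
  show "x * y \<noteq> 0" by (auto simp: padic_int_eq_0_iff)
qed

lemma padic_int_val_mult:
  fixes x y :: "'p :: prime_card padic_int"
  assumes "x \<noteq> 0" "y \<noteq> 0"
  shows "padic_int_val (x * y) = padic_int_val x + padic_int_val y"
proof -
  have "x * y \<noteq> 0" using assms by simp
  then have "n \<le> padic_int_val (x * y) \<longleftrightarrow> n \<le> padic_int_val x + padic_int_val y" for n
    using padic_int_mult_residue[OF assms] residue_eq_0_iff[of "x * y"] by simp
  from this[of "padic_int_val (x * y)"] this[of "padic_int_val x + padic_int_val y"]
  show ?thesis by simp
qed

type_synonym 'p padic = "'p padic_int fract"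

definition padic_val :: "'p :: prime_card padic \<Rightarrow> rat extended" where
  "padic_val q =
    (if q = 0 then Pinf
     else THE v. \<exists>a b. a \<noteq> 0 \<and> b \<noteq> 0 \<and> q = Fract a b \<and>
            v = Fin (of_nat (padic_int_val a) - of_nat (padic_int_val b)))"

lemma padic_val_Fract:
  fixes a b :: "'p :: prime_card padic_int"
  assumes b: "b \<noteq> 0"
  shows "padic_val (Fract a b) =
    (if a = 0 then Pinf else Fin (of_nat (padic_int_val a) - of_nat (padic_int_val b)))"
proof (cases "a = 0")
  case True
  then show ?thesis by (simp add: padic_val_def fract_collapse)
next
  case False
  have "of_nat (padic_int_val c) - of_nat (padic_int_val d)
      = (of_nat (padic_int_val a) - of_nat (padic_int_val b) :: rat)"
    if h: "c \<noteq> 0" "d \<noteq> 0" "Fract a b = Fract c d" for c d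
  proof -
    have "a * d = c * b" using h b by (simp add: eq_fract)
    then have "padic_int_val a + padic_int_val d = padic_int_val c + padic_int_val b"
      using h b False by (metis padic_int_val_mult)
    then have "(of_nat (padic_int_val a) + of_nat (padic_int_val d) :: rat)
        = of_nat (padic_int_val c) + of_nat (padic_int_val b)"
      by (metis of_nat_add)
    then show ?thesis by (simp add: algebra_simps)
  qed
  then have "(THE v. \<exists>c d. c \<noteq> 0 \<and> d \<noteq> 0 \<and> Fract a b = Fract c d \<and>
        v = Fin (of_nat (padic_int_val c) - of_nat (padic_int_val d) :: rat))
      = Fin (of_nat (padic_int_val a) - of_nat (padic_int_val b))"
    using False b by (intro the_equality) blast+
  moreover have "Fract a b \<noteq> 0" using False b by (simp add: Zero_fract_def eq_fract)
  ultimately show ?thesis using False by (simp add: padic_val_def)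
qed

lemma padic_val_p: "padic_val (of_nat CARD('p) :: 'p :: prime_card padic) = 1"
proof -
  have p1: "1 < int CARD('p)" using prime_gt_1_nat[OF prime_card[where ?'a = 'p]] by simp
  have r: "residue (of_nat CARD('p) :: 'p padic_int) 2 \<noteq> 0"
    "residue (of_nat CARD('p) :: 'p padic_int) 1 = 0"
    using p1 by (simp_all add: residue_of_nat power2_eq_square)
  then have n0: "(of_nat CARD('p) :: 'p padic_int) \<noteq> 0" by (auto simp: padic_int_eq_0_iff)
  have v: "padic_int_val (of_nat CARD('p) :: 'p padic_int) = 1"
    using r unfolding residue_eq_0_iff[OF n0] by linarith
  have "residue (1 :: 'p padic_int) 1 \<noteq> 0" using p1 by (simp add: one_padic_int.rep_eq)
  then have v1: "padic_int_val (1 :: 'p padic_int) = 0"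
    by (subst (asm) residue_eq_0_iff) auto
  have "(of_nat CARD('p) :: 'p padic) = Fract (of_nat CARD('p)) 1" by (rule of_nat_fract)
  then show ?thesis using n0 by (simp add: padic_val_Fract v v1 one_extended_def)
qed

definition rat_val :: "nat \<Rightarrow> rat \<Rightarrow> rat extended" where
  "rat_val p r =
    (if r = 0 then Pinf
     else Fin (of_nat (multiplicity (int p) (fst (quotient_of r)))
             - of_nat (multiplicity (int p) (snd (quotient_of r)))))"

section \<open>Finite extensions and their valuations\<close>

definition finite_extension :: "('f :: field \<Rightarrow> 'k :: field) \<Rightarrow> bool" where
  "finite_extension \<iota> \<longleftrightarrow>
     field_hom \<iota> \<and> (\<exists>B. finite B \<and> module.span (\<lambda>a x. \<iota> a * x) B = UNIV)"

definition discrete_valuation :: "('k :: field \<Rightarrow> rat extended) \<Rightarrow> bool" where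
  "discrete_valuation \<nu> \<longleftrightarrow>
     (\<forall>x. \<nu> x \<noteq> Minf) \<and>
     (\<forall>x. \<nu> x = Pinf \<longleftrightarrow> x = 0) \<and>
     (\<forall>x y. \<nu> (x * y) = \<nu> x + \<nu> y) \<and>
     (\<forall>x y. min (\<nu> x) (\<nu> y) \<le> \<nu> (x + y)) \<and>
     (\<exists>g > 0. {q. \<exists>x. \<nu> x = Fin q} = range (\<lambda>n :: int. of_int n * g))"

definition integer_ring :: "('k :: field \<Rightarrow> rat extended) \<Rightarrow> 'k set" where
  "integer_ring \<nu> = {x. 0 \<le> \<nu> x}"

definition integer_units :: "('k :: field \<Rightarrow> rat extended) \<Rightarrow> 'k set" where
  "integer_units \<nu> = {x \<in> integer_ring \<nu>. \<exists>y \<in> integer_ring \<nu>. x * y = 1}"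

definition max_ideal :: "('k :: field \<Rightarrow> rat extended) \<Rightarrow> 'k set" where
  "max_ideal \<nu> = {x. 0 < \<nu> x}"

definition principal_ideal :: "('k :: field \<Rightarrow> rat extended) \<Rightarrow> 'k \<Rightarrow> 'k set" where
  "principal_ideal \<nu> a = {a * r | r. r \<in> integer_ring \<nu>}"

primrec max_ideal_power :: "('k :: field \<Rightarrow> rat extended) \<Rightarrow> nat \<Rightarrow> 'k set" where
  "max_ideal_power \<nu> 0 = integer_ring \<nu>"
| "max_ideal_power \<nu> (Suc n) =
     group_closure {a * b | a b. a \<in> max_ideal \<nu> \<and> b \<in> max_ideal_power \<nu> n}"

definition is_uniformizer :: "('k :: field \<Rightarrow> rat extended) \<Rightarrow> 'k \<Rightarrow> bool" where
  "is_uniformizer \<nu> \<pi> \<longleftrightarrow> max_ideal \<nu> = principal_ideal \<nu> \<pi>"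

definition is_ramification_index :: "nat \<Rightarrow> ('k :: field \<Rightarrow> rat extended) \<Rightarrow> nat \<Rightarrow> bool" where
  "is_ramification_index p \<nu> e \<longleftrightarrow> principal_ideal \<nu> (of_nat p) = max_ideal_power \<nu> e"

section \<open>Arithmetic partial derivatives\<close>

text \<open>For a valuation \<open>\<nu>\<close> the second case below is exactly \<open>x = 0\<close>.\<close>

definition partial_deriv ::
    "nat \<Rightarrow> ('k :: field_char_0 \<Rightarrow> rat extended) \<Rightarrow> 'k \<Rightarrow> 'k" where
  "partial_deriv p \<nu> x = (case \<nu> x of Fin q \<Rightarrow> x * of_rat q / of_nat p | _ \<Rightarrow> 0)"

definition anti_partial_derivs ::
    "nat \<Rightarrow> ('k :: field_char_0 \<Rightarrow> rat extended) \<Rightarrow> 'k \<Rightarrow> 'k set" where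
  "anti_partial_derivs p \<nu> y = {x. partial_deriv p \<nu> x = y}"

definition has_exponent ::
    "nat \<Rightarrow> ('k :: field \<Rightarrow> rat extended) \<Rightarrow> 'k \<Rightarrow> int \<Rightarrow> bool" where
  "has_exponent p \<nu> x k \<longleftrightarrow> (\<exists>b. rat_val p b = 0 \<and> \<nu> x = Fin (b * of_nat p powi k))"

definition is_primitive_anti_partial_deriv ::
    "nat \<Rightarrow> ('k :: field_char_0 \<Rightarrow> rat extended) \<Rightarrow> 'k \<Rightarrow> 'k \<Rightarrow> bool" where
  "is_primitive_anti_partial_deriv p \<nu> y x\<^sub>0 \<longleftrightarrow>
     x\<^sub>0 \<in> anti_partial_derivs p \<nu> y \<and>
     (\<exists>k\<^sub>0. has_exponent p \<nu> x\<^sub>0 k\<^sub>0 \<and>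
        (\<forall>x \<in> anti_partial_derivs p \<nu> y. \<forall>k. has_exponent p \<nu> x k \<longrightarrow> k\<^sub>0 \<le> k))"

text \<open>The set \<open>C(x\<^sub>0)\<close> for \<open>\<nu> x\<^sub>0 = b\<^sub>0 * p ^ k\<^sub>0\<close>.\<close>

definition C_set :: "nat \<Rightarrow> rat \<Rightarrow> int \<Rightarrow> nat set" where
  "C_set p b\<^sub>0 k\<^sub>0 = {c. rat_val p (b\<^sub>0 - of_nat c) = Fin (of_nat p powi k\<^sub>0 * of_nat c)}"

end

theory Submission
  imports Defs
begin

text \<open>
  If \<open>x * q = x\<^sub>0 * q\<^sub>0\<close> with \<open>q = \<nu> x = b * p ^ k\<close> and \<open>q\<^sub>0 = \<nu> x\<^sub>0 = b\<^sub>0 * p ^ k\<^sub>0\<close>, then applying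
  \<open>\<nu>\<close>, which restricts to the p-adic valuation on the rationals, gives
  \<open>k - k\<^sub>0 = p ^ k\<^sub>0 * (b\<^sub>0 - b * p ^ (k - k\<^sub>0))\<close>. Since \<open>k \<ge> k\<^sub>0\<close> by primitivity, the second factor is
  p-integral, so it is a natural number \<open>c\<close>, and \<open>b\<^sub>0 - c\<close> has valuation \<open>k - k\<^sub>0 = p ^ k\<^sub>0 * c\<close>.
  The corresponding anti-partial derivative is \<open>x\<^sub>0 * b\<^sub>0 / (b\<^sub>0 - c)\<close>.
\<close>

section \<open>Rational-valued discrete valuations normalized by \<nu>(p) = 1\<close>

locale p_valuation =
  fixes p :: nat and \<nu> :: "'k :: field_char_0 \<Rightarrow> rat extended"
  assumes prime_p: "prime p"
    and discrete: "discrete_valuation \<nu>"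
    and val_p: "\<nu> (of_nat p) = 1"
begin

text \<open>Junk value: \<open>fval 0 = 0\<close>.\<close>

definition fval :: "'k \<Rightarrow> rat" where
  "fval x = (case \<nu> x of Fin q \<Rightarrow> q | _ \<Rightarrow> 0)"

lemma val_zero: "\<nu> x = Pinf \<longleftrightarrow> x = 0"
  using discrete unfolding discrete_valuation_def by blast

lemma val_eq_Fin: "x \<noteq> 0 \<Longrightarrow> \<nu> x = Fin (fval x)"
  using discrete val_zero[of x] unfolding discrete_valuation_def fval_def
  by (cases "\<nu> x") auto

lemma val_Fin_iff: "\<nu> x = Fin q \<longleftrightarrow> x \<noteq> 0 \<and> fval x = q"
  using val_eq_Fin[of x] val_zero[of x] by auto

lemma fval_mult: "x \<noteq> 0 \<Longrightarrow> y \<noteq> 0 \<Longrightarrow> fval (x * y) = fval x + fval y"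
proof -
  assume "x \<noteq> 0" "y \<noteq> 0"
  moreover have "\<nu> (x * y) = \<nu> x + \<nu> y"
    using discrete unfolding discrete_valuation_def by blast
  ultimately show ?thesis by (simp add: val_eq_Fin)
qed

lemma fval_add: "x \<noteq> 0 \<Longrightarrow> y \<noteq> 0 \<Longrightarrow> x + y \<noteq> 0 \<Longrightarrow> min (fval x) (fval y) \<le> fval (x + y)"
proof -
  assume "x \<noteq> 0" "y \<noteq> 0" "x + y \<noteq> 0"
  moreover have "min (\<nu> x) (\<nu> y) \<le> \<nu> (x + y)"
    using discrete unfolding discrete_valuation_def by blast
  ultimately show ?thesis by (simp add: val_eq_Fin min_def split: if_splits)
qed

lemma fval_one [simp]: "fval 1 = 0"
  using fval_mult[of 1 1] by simp

lemma fval_inverse: "x \<noteq> 0 \<Longrightarrow> fval (inverse x) = - fval x"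
  using fval_mult[of x "inverse x"] by simp

lemma fval_divide: "x \<noteq> 0 \<Longrightarrow> y \<noteq> 0 \<Longrightarrow> fval (x / y) = fval x - fval y"
  by (simp add: divide_inverse fval_mult fval_inverse)

lemma fval_power: "x \<noteq> 0 \<Longrightarrow> fval (x ^ n) = of_nat n * fval x"
  by (induction n) (simp_all add: fval_mult algebra_simps)

lemma fval_powi: "x \<noteq> 0 \<Longrightarrow> fval (x powi n) = of_int n * fval x"
  by (cases n rule: int_cases2) (simp_all add: fval_power fval_inverse power_int_minus)

lemma fval_minus: "fval (- x) = fval x"
proof (cases "x = 0")
  case False
  \<comment> \<open>The square of -1 is 1, so twice its valuation is 0.\<close>
  have "fval (-1) = 0" using fval_mult[of "-1" "-1"] by simp
  then show ?thesis using False fval_mult[of "-1" x] by simp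
qed simp

lemma p_pos [simp]: "p > 0" "p \<noteq> 0"
  using prime_p prime_gt_0_nat by auto

lemma fval_p [simp]: "fval (of_nat p) = 1"
  using val_p by (simp add: val_Fin_iff one_extended_def)

section \<open>Restriction of the valuation to the integers and rationals\<close>

lemma fval_of_nat_nonneg: "n \<noteq> 0 \<Longrightarrow> 0 \<le> fval (of_nat n)"
proof (induction n)
  case (Suc n)
  then show ?case
    using fval_add[of 1 "of_nat n"] of_nat_neq_0[of n, where 'a = 'k]
    by (cases "n = 0") (auto simp: min_def split: if_splits)
qed simp

lemma fval_of_int_nonneg: "n \<noteq> 0 \<Longrightarrow> 0 \<le> fval (of_int n)"
  by (cases n rule: int_cases2) (simp_all add: fval_minus fval_of_nat_nonneg)

text \<open>Bezout writes 1 as u p + v n. If n had positive valuation, so would every nonzero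
  summand, contradicting \<nu>(1) = 0.\<close>

lemma fval_of_int_coprime:
  assumes "\<not> int p dvd n"
  shows "fval (of_int n) = 0"
proof (rule ccontr)
  assume c: "fval (of_int n) \<noteq> 0"
  have n: "n \<noteq> 0" using assms by auto
  have pos: "0 < fval (of_int n)" using c fval_of_int_nonneg[OF n] by simp
  have "coprime (int p) n" using assms prime_p by (simp add: prime_imp_coprime)
  then obtain u v where uv: "u * int p + v * n = 1"
    using bezout_int[of "int p" n] by auto
  have "1 < int p" using prime_p prime_gt_1_nat by simp
  \<comment> \<open>Otherwise u p = 1 with p > 1. The case u = 0 is split off below because
    \<open>fval_add\<close> requires nonzero summands.\<close>
  then have v: "v \<noteq> 0" using uv by (auto simp: zmult_eq_1_iff)
  have vn: "0 < fval (of_int (v * n))"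
    using fval_of_int_nonneg[OF v] pos n v by (simp add: fval_mult)
  have eq: "of_int (u * int p) + of_int (v * n) = (1 :: 'k)"
    using uv by (metis of_int_1 of_int_add)
  show False
  proof (cases "u = 0")
    case True
    then show False using eq vn by simp
  next
    case False
    have "0 < fval (of_int (u * int p))"
      using fval_of_int_nonneg[OF False] False by (simp add: fval_mult)
    then show False
      using fval_add[of "of_int (u * int p)" "of_int (v * n)"] eq vn False v n
      by (auto simp: min_def split: if_splits)
  qed
qed

lemma fval_of_int: "n \<noteq> 0 \<Longrightarrow> fval (of_int n) = of_nat (multiplicity (int p) n)"
proof -
  assume n: "n \<noteq> 0"
  have "\<not> is_unit (int p)" using prime_p by auto
  from multiplicity_decompose'[OF n this] obtain t
    where t: "n = int p ^ multiplicity (int p) n * t" "\<not> int p dvd t" by blast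
  have "t \<noteq> 0" using t(2) by auto
  have "fval (of_int n) = fval (of_nat p ^ multiplicity (int p) n * of_int t)"
    by (subst t(1)) simp
  then show ?thesis
    using \<open>t \<noteq> 0\<close> fval_of_int_coprime[OF t(2)] by (simp add: fval_mult fval_power)
qed

text \<open>Numerator and denominator are powers of p times integers of valuation 0, and \<nu>(p) =
  1 fixes the scale. This lets every later computation with \<open>rat_val\<close> take place in the
  field through \<open>fval\<close>.\<close>

lemma rat_val_eq_val: "rat_val p r = \<nu> (of_rat r)"
proof (cases "r = 0")
  case True
  then show ?thesis using val_zero[of 0] by (simp add: rat_val_def)
next
  case False
  obtain a d where ad: "quotient_of r = (a, d)" by fastforce
  have r: "r = of_int a / of_int d" and d: "d > 0"
    using quotient_of_div[OF ad] quotient_of_denom_pos[OF ad] by auto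
  have a: "a \<noteq> 0" using r False by auto
  have "fval (of_rat r) = fval (of_int a / of_int d)" by (simp add: r of_rat_divide)
  then show ?thesis
    using False a d ad by (simp add: rat_val_def val_eq_Fin fval_divide fval_of_int)
qed

lemma rat_val_Fin_iff: "rat_val p r = Fin v \<longleftrightarrow> r \<noteq> 0 \<and> fval (of_rat r) = v"
  by (simp add: rat_val_eq_val val_Fin_iff)

lemma rat_val_0_iff: "rat_val p r = 0 \<longleftrightarrow> r \<noteq> 0 \<and> fval (of_rat r) = 0"
  by (simp add: zero_extended_def rat_val_Fin_iff)

lemma of_rat_powi: "(of_rat (r powi n) :: 'k) = of_rat r powi n"
  by (cases n rule: int_cases2) (simp_all add: power_int_minus of_rat_inverse of_rat_power)

text \<open>Recovers k from the rational number b p^k, so the exponent of an element is well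
  defined.\<close>

lemma fval_of_rat_p_powi:
  "rat_val p b = 0 \<Longrightarrow> fval (of_rat (b * of_nat p powi k)) = of_int k"
  by (simp add: rat_val_0_iff of_rat_mult of_rat_powi fval_mult fval_powi)

lemma ex_unit_times_p_powi:
  assumes "r \<noteq> 0"
  obtains b k where "rat_val p b = 0" "r = b * of_nat p powi k"
proof -
  \<comment> \<open>The p-adic valuation of r, read off its reduced fraction as an integer so that
    it can serve as an exponent.\<close>
  define k where "k = int (multiplicity (int p) (fst (quotient_of r)))
    - int (multiplicity (int p) (snd (quotient_of r)))"
  have "rat_val p r = Fin (of_int k)" using assms by (simp add: rat_val_def k_def)
  then have "rat_val p (r / of_nat p powi k) = 0"
    by (simp add: rat_val_Fin_iff rat_val_0_iff of_rat_divide of_rat_powi fval_divide fval_powi)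
  then show ?thesis by (rule that[of "r / of_nat p powi k" k]) simp
qed

section \<open>Units, powers of \<pi>, and the equation for anti-partial derivatives\<close>

lemma fval_unit:
  assumes "u \<in> integer_units \<nu>"
  shows "u \<noteq> 0" "fval u = 0"
proof -
  obtain y where y: "0 \<le> \<nu> u" "0 \<le> \<nu> y" "u * y = 1"
    using assms unfolding integer_units_def integer_ring_def by blast
  then have nz: "u \<noteq> 0" "y \<noteq> 0" by auto
  have "0 \<le> fval u" "0 \<le> fval y" using y nz by (simp_all add: val_eq_Fin zero_extended_def)
  moreover have "fval u + fval y = 0" using fval_mult[OF nz] y(3) by simp
  ultimately show "u \<noteq> 0" "fval u = 0" using nz by auto
qed

text \<open>Applying \<nu> to p = \<alpha>_p \<pi>^e gives e \<nu>(\<pi>) = 1, and units have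
  valuation 0. This turns the shape \<alpha> \<pi>^m of an element into its valuation.\<close>

lemma val_unit_times_powi:
  assumes u: "\<alpha> \<in> integer_units \<nu>" and up: "\<alpha>\<^sub>p \<in> integer_units \<nu>"
    and p: "of_nat p = \<alpha>\<^sub>p * \<pi> ^ e" and m: "of_int m = of_nat e * q"
  shows "\<nu> (\<alpha> * \<pi> powi m) = Fin q" "\<pi> \<noteq> 0"
proof -
  have "\<alpha>\<^sub>p * \<pi> ^ e \<noteq> 0" by (simp add: p[symmetric])
  then have pe: "\<pi> ^ e \<noteq> 0" by simp
  have val_pe: "fval (\<pi> ^ e) = 1"
    using fval_mult[OF fval_unit(1)[OF up] pe] fval_unit(2)[OF up] by (simp add: p[symmetric])
  \<comment> \<open>With e = 0 the power would be 1, of valuation 0. Once e is nonzero, \<pi> = 0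
    would make the power vanish.\<close>
  then have "e \<noteq> 0" by (intro notI) simp
  then show pi: "\<pi> \<noteq> 0" using pe by auto
  have "of_nat e * fval \<pi> = 1" using val_pe fval_power[OF pi] by simp
  then have "of_int m * fval \<pi> = q" by (simp add: m mult.commute mult.left_commute)
  then show "\<nu> (\<alpha> * \<pi> powi m) = Fin q"
    using pi fval_unit[OF u] by (simp add: val_Fin_iff fval_mult fval_powi)
qed

text \<open>The common factor 1/p cancels. Since \<open>q\<^sub>0\<close> is nonzero, the derivative
  of \<open>x\<^sub>0\<close> is nonzero, which rules out x = 0.\<close>

lemma anti_partial_derivs_iff:
  assumes "\<nu> x\<^sub>0 = Fin q\<^sub>0" "q\<^sub>0 \<noteq> 0"
  shows "x \<in> anti_partial_derivs p \<nu> (partial_deriv p \<nu> x\<^sub>0) \<longleftrightarrow>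
    x \<noteq> 0 \<and> x * of_rat (fval x) = x\<^sub>0 * of_rat q\<^sub>0"
proof (cases "x = 0")
  case True
  then show ?thesis
    using assms val_zero[of 0] val_zero[of x\<^sub>0]
    by (auto simp: anti_partial_derivs_def partial_deriv_def)
next
  case False
  then show ?thesis
    using assms by (simp add: anti_partial_derivs_def partial_deriv_def val_eq_Fin)
qed

end

section \<open>Parametrization of the anti-partial derivatives by \<open>C_set\<close>\<close>

locale primitive_anti_partial_deriv = p_valuation +
  fixes x\<^sub>0 :: 'a and b\<^sub>0 :: rat and k\<^sub>0 :: int
  assumes primitive: "is_primitive_anti_partial_deriv p \<nu> (partial_deriv p \<nu> x\<^sub>0) x\<^sub>0"
    and val_x0: "\<nu> x\<^sub>0 = Fin (b\<^sub>0 * of_nat p powi k\<^sub>0)"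
    and val_b0: "rat_val p b\<^sub>0 = 0"
    and k0_pos: "k\<^sub>0 > 0"
begin

abbreviation antis where "antis \<equiv> anti_partial_derivs p \<nu> (partial_deriv p \<nu> x\<^sub>0)"

lemma b0_nonzero: "b\<^sub>0 \<noteq> 0" and fval_b0: "fval (of_rat b\<^sub>0) = 0"
  using val_b0 by (simp_all add: rat_val_0_iff)

lemma x0_nonzero: "x\<^sub>0 \<noteq> 0" and fval_x0: "fval x\<^sub>0 = b\<^sub>0 * of_nat p powi k\<^sub>0"
  using val_x0 by (simp_all add: val_Fin_iff)

lemma anti_iff:
  "x \<in> antis \<longleftrightarrow> x \<noteq> 0 \<and> x * of_rat (fval x) = x\<^sub>0 * of_rat (b\<^sub>0 * of_nat p powi k\<^sub>0)"
  by (rule anti_partial_derivs_iff[OF val_x0]) (simp add: b0_nonzero)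

text \<open>Primitivity only provides some minimal exponent \<open>k1\<close> of
  \<open>x\<^sub>0\<close>; uniqueness of exponents identifies it with
  \<open>k\<^sub>0\<close>.\<close>

lemma exponent_ge:
  assumes "x \<in> antis" "\<nu> x = Fin (b * of_nat p powi k)" "rat_val p b = 0"
  shows "k\<^sub>0 \<le> k"
proof -
  obtain k1 where k1: "has_exponent p \<nu> x\<^sub>0 k1"
    and le: "\<And>x k. x \<in> antis \<Longrightarrow> has_exponent p \<nu> x k \<Longrightarrow> k1 \<le> k"
    using primitive unfolding is_primitive_anti_partial_deriv_def by blast
  obtain b1 where "rat_val p b1 = 0" "\<nu> x\<^sub>0 = Fin (b1 * of_nat p powi k1)"
    using k1 unfolding has_exponent_def by blast
  then have "k1 = k\<^sub>0"
    using val_x0 fval_of_rat_p_powi[of b1 k1] fval_of_rat_p_powi[OF val_b0, of k\<^sub>0] by simp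
  moreover have "has_exponent p \<nu> x k" using assms unfolding has_exponent_def by blast
  ultimately show ?thesis using le assms(1) by blast
qed

text \<open>The formula for x yields surjectivity of the correspondence; the relations between b, k
  and c yield the explicit description of k, b and \<alpha>.\<close>

lemma anti_parameter:
  assumes x: "x \<in> antis" and vx: "\<nu> x = Fin (b * of_nat p powi k)" and b: "rat_val p b = 0"
  obtains c where "c \<in> C_set p b\<^sub>0 k\<^sub>0" "k = int p ^ nat k\<^sub>0 * int c + k\<^sub>0"
    "b\<^sub>0 - of_nat c = b * of_nat p powi (k - k\<^sub>0)"
    "x = x\<^sub>0 * of_rat b\<^sub>0 / of_rat (b\<^sub>0 - of_nat c)"
    "b\<^sub>0 * of_nat p powi k\<^sub>0 - b * of_nat p powi k = of_int (k - k\<^sub>0)"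
proof -
  have ge: "k\<^sub>0 \<le> k" by (rule exponent_ge[OF assms])
  have x0: "x \<noteq> 0" and fval_x: "fval x = b * of_nat p powi k" using vx by (simp_all add: val_Fin_iff)
  have b0: "b \<noteq> 0" using b by (simp add: rat_val_0_iff)
  have eq: "x * of_rat (b * of_nat p powi k) = x\<^sub>0 * of_rat (b\<^sub>0 * of_nat p powi k\<^sub>0)"
    using x fval_x by (simp add: anti_iff)
  then have "fval (x * of_rat (b * of_nat p powi k)) = fval (x\<^sub>0 * of_rat (b\<^sub>0 * of_nat p powi k\<^sub>0))"
    by simp
  \<comment> \<open>On each side the element contributes its valuation, and the rational factor
    contributes its exponent.\<close>
  then have "b * of_nat p powi k + of_int k = b\<^sub>0 * of_nat p powi k\<^sub>0 + of_int k\<^sub>0"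
    using x0 b0 b0_nonzero x0_nonzero fval_of_rat_p_powi[OF b] fval_of_rat_p_powi[OF val_b0]
    by (subst (asm) (1 2) fval_mult) (simp_all add: fval_x fval_x0)
  then have diff: "b\<^sub>0 * of_nat p powi k\<^sub>0 - b * of_nat p powi k = of_int (k - k\<^sub>0)" by simp
  have split: "of_nat p powi k = (of_nat p powi k\<^sub>0 * of_nat p powi (k - k\<^sub>0) :: rat)"
    by (simp flip: power_int_add)
  \<comment> \<open>The future parameter c, so far only a rational number.\<close>
  define c' where "c' = b\<^sub>0 - b * of_nat p powi (k - k\<^sub>0)"
  have c': "c' * of_nat p powi k\<^sub>0 = of_int (k - k\<^sub>0)"
    unfolding diff[symmetric] c'_def split by (simp add: algebra_simps)
  \<comment> \<open>By \<open>c'\<close>, the valuation of \<open>k - k\<^sub>0\<close> is that of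
    \<open>c'\<close> plus \<open>k\<^sub>0\<close>, so it suffices that \<open>c'\<close> is
    p-integral. The case \<open>k = k\<^sub>0\<close> is separate because 0 has no finite
    valuation.\<close>
  have "int p ^ nat k\<^sub>0 dvd k - k\<^sub>0"
  proof (cases "k = k\<^sub>0")
    case False
    then have n0: "k - k\<^sub>0 \<noteq> 0" by simp
    then have "c' \<noteq> 0" using c' by auto
    \<comment> \<open>The two terms of \<open>c'\<close> have valuations 0 and
      \<open>k - k\<^sub>0\<close>; the latter is nonnegative by primitivity.\<close>
    have "0 \<le> fval (of_rat c')"
    proof -
      have "fval (of_rat b\<^sub>0) = 0" "fval (of_rat (- (b * of_nat p powi (k - k\<^sub>0)))) = of_int (k - k\<^sub>0)"
        using fval_b0 fval_of_rat_p_powi[OF b, of "k - k\<^sub>0"] by (simp_all add: of_rat_minus fval_minus)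
      moreover have "of_rat c' = (of_rat b\<^sub>0 + of_rat (- (b * of_nat p powi (k - k\<^sub>0))) :: 'a)"
        by (simp add: c'_def flip: of_rat_add)
      moreover have "(of_rat c' :: 'a) \<noteq> 0" using \<open>c' \<noteq> 0\<close> by simp
      ultimately show ?thesis
        using fval_add[of "of_rat b\<^sub>0" "of_rat (- (b * of_nat p powi (k - k\<^sub>0)))"]
          b0 b0_nonzero ge by simp
    qed
    moreover have "fval (of_int (k - k\<^sub>0)) = fval (of_rat c') + of_int k\<^sub>0"
    proof -
      have "of_int (k - k\<^sub>0) = (of_rat (c' * of_nat p powi k\<^sub>0) :: 'a)"
        by (simp only: c' of_rat_of_int_eq)
      then show ?thesis using \<open>c' \<noteq> 0\<close> by (simp add: of_rat_mult of_rat_powi fval_mult fval_powi)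
    qed
    ultimately have "rat_of_int k\<^sub>0 \<le> of_int (int (multiplicity (int p) (k - k\<^sub>0)))"
      using fval_of_int[OF n0] by simp
    then have "nat k\<^sub>0 \<le> multiplicity (int p) (k - k\<^sub>0)" 
      unfolding of_int_le_iff by simp
    then show ?thesis by (rule multiplicity_dvd')
  qed simp
  then obtain d where d: "k - k\<^sub>0 = int p ^ nat k\<^sub>0 * d" by (rule dvdE)
  have ppos: "0 < int p ^ nat k\<^sub>0" using prime_p prime_gt_0_nat by simp
  \<comment> \<open>Primitivity again: \<open>k\<^sub>0 \<le> k\<close> makes the parameter a
    natural number and not merely an integer.\<close>
  have "0 \<le> d" using d ge ppos by (metis diff_ge_0_iff_ge zero_le_mult_iff not_less)
  then obtain c where c: "d = int c" by (rule nonneg_int_cases)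
  have powi_k0: "of_nat p powi k\<^sub>0 = (of_nat p ^ nat k\<^sub>0 :: rat)"
    using k0_pos by (simp add: power_int_def)
  \<comment> \<open>Both sides equal \<open>k - k\<^sub>0\<close>; cancelling the power of p
    identifies \<open>c'\<close> with c.\<close>
  have "c' * of_nat p powi k\<^sub>0 = of_nat c * of_nat p powi k\<^sub>0"
    unfolding c' d c by (simp add: powi_k0 mult.commute)
  then have "c' = of_nat c" by simp
  then have bc: "b\<^sub>0 - of_nat c = b * of_nat p powi (k - k\<^sub>0)" by (simp add: c'_def)
  have "rat_val p (b\<^sub>0 - of_nat c) = Fin (of_int (k - k\<^sub>0))"
    unfolding rat_val_Fin_iff using fval_of_rat_p_powi[OF b, of "k - k\<^sub>0"] b0 by (simp add: bc)
  also have "rat_of_int (k - k\<^sub>0) = of_nat p powi k\<^sub>0 * of_nat c"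
    using c' \<open>c' = of_nat c\<close> by (simp add: mult.commute)
  finally have "c \<in> C_set p b\<^sub>0 k\<^sub>0" by (simp add: C_set_def)
  moreover have "k = int p ^ nat k\<^sub>0 * int c + k\<^sub>0" using d c by simp
  \<comment> \<open>Cancelling p to the power \<open>k\<^sub>0\<close> in \<open>eq\<close> leaves
    the denominator \<open>b * of_nat p powi (k - k\<^sub>0)\<close>, which is
    \<open>b\<^sub>0 - of_nat c\<close> by \<open>bc\<close>.\<close>
  moreover have "x = x\<^sub>0 * of_rat b\<^sub>0 / of_rat (b\<^sub>0 - of_nat c)"
    using eq b0 unfolding bc split
    by (simp add: field_simps of_rat_mult of_rat_powi)
  ultimately show ?thesis using that bc diff by blast
qed

text \<open>Dividing by \<open>b\<^sub>0 - of_nat c\<close> lowers the valuation by exactly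
  \<open>of_nat p powi k\<^sub>0 * of_nat c\<close>. The new valuation is therefore
  \<open>b\<^sub>0 - of_nat c\<close> times the power of p, and multiplying by it clears the
  denominator.\<close>

lemma C_set_imp_anti:
  assumes "c \<in> C_set p b\<^sub>0 k\<^sub>0"
  shows "x\<^sub>0 * of_rat b\<^sub>0 / of_rat (b\<^sub>0 - of_nat c) \<in> antis"
proof -
  have nz: "b\<^sub>0 - of_nat c \<noteq> 0" and fval_c: "fval (of_rat (b\<^sub>0 - of_nat c)) = of_nat p powi k\<^sub>0 * of_nat c"
    using assms by (simp_all add: C_set_def rat_val_Fin_iff)
  let ?d = "of_rat (b\<^sub>0 - of_nat c) :: 'a"
  have nz': "?d \<noteq> 0" using nz by simp
  have "fval (x\<^sub>0 * of_rat b\<^sub>0 / ?d) = fval x\<^sub>0 + fval (of_rat b\<^sub>0) - fval ?d"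
    using nz' b0_nonzero x0_nonzero by (subst fval_divide) (simp_all add: fval_mult)
  also have "\<dots> = (b\<^sub>0 - of_nat c) * of_nat p powi k\<^sub>0"
    unfolding fval_c fval_b0 fval_x0 by (simp add: algebra_simps)
  finally show ?thesis
    unfolding anti_iff using nz' b0_nonzero x0_nonzero by (simp add: of_rat_mult)
qed

lemma bij_betw_C_set_antis:
  "bij_betw (\<lambda>c. x\<^sub>0 * of_rat b\<^sub>0 / of_rat (b\<^sub>0 - of_nat c)) (C_set p b\<^sub>0 k\<^sub>0) antis"
  unfolding bij_betw_def
proof (intro conjI inj_onI equalityI subsetI)
  fix c d
  assume "c \<in> C_set p b\<^sub>0 k\<^sub>0" "d \<in> C_set p b\<^sub>0 k\<^sub>0"
    and eq: "x\<^sub>0 * of_rat b\<^sub>0 / of_rat (b\<^sub>0 - of_nat c) = x\<^sub>0 * of_rat b\<^sub>0 / of_rat (b\<^sub>0 - of_nat d)"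
  then have "b\<^sub>0 - of_nat c \<noteq> 0" "b\<^sub>0 - of_nat d \<noteq> 0"
    unfolding C_set_def mem_Collect_eq rat_val_Fin_iff by blast+
  then have "(of_rat (b\<^sub>0 - of_nat c) :: 'a) \<noteq> 0" "(of_rat (b\<^sub>0 - of_nat d) :: 'a) \<noteq> 0"
    by simp_all
  with eq have "(of_rat (b\<^sub>0 - of_nat c) :: 'a) = of_rat (b\<^sub>0 - of_nat d)"
    using x0_nonzero b0_nonzero by (simp add: frac_eq_eq)
  then show "c = d" unfolding of_rat_eq_iff by simp
next
  fix x
  assume "x \<in> (\<lambda>c. x\<^sub>0 * of_rat b\<^sub>0 / of_rat (b\<^sub>0 - of_nat c)) ` C_set p b\<^sub>0 k\<^sub>0"
  then show "x \<in> antis" using C_set_imp_anti by blast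
next
  fix x
  assume x: "x \<in> antis"
  \<comment> \<open>A zero valuation would make the left side of \<open>anti_iff\<close> vanish,
    while its right side is nonzero. Only nonzero valuations have the form b p^k.\<close>
  then have "x \<noteq> 0" "fval x \<noteq> 0" using x0_nonzero b0_nonzero by (auto simp: anti_iff)
  obtain b k where b: "rat_val p b = 0" and k: "fval x = b * of_nat p powi k"
    using ex_unit_times_p_powi[OF \<open>fval x \<noteq> 0\<close>] .
  have "\<nu> x = Fin (b * of_nat p powi k)" using \<open>x \<noteq> 0\<close> k by (simp add: val_eq_Fin)
  from anti_parameter[OF x this b]
  show "x \<in> (\<lambda>c. x\<^sub>0 * of_rat b\<^sub>0 / of_rat (b\<^sub>0 - of_nat c)) ` C_set p b\<^sub>0 k\<^sub>0" by blast
qed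

end

section \<open>Application to extensions of the p-adic numbers\<close>

lemma val_prime:
  fixes \<iota> :: "'p :: prime_card padic \<Rightarrow> 'k :: field"
  assumes "finite_extension \<iota>" "\<And>a. \<nu> (\<iota> a) = padic_val a"
  shows "\<nu> (of_nat CARD('p)) = 1"
proof -
  interpret field_hom \<iota> using assms(1) unfolding finite_extension_def by simp
  \<comment> \<open>The embedding preserves natural numbers, so the normalization carries over from
    the p-adic valuation.\<close>
  have "\<nu> (\<iota> (of_nat CARD('p))) = 1" using assms(2) padic_val_p by metis
  then show ?thesis by (simp add: hom_of_nat)
qed

text \<open>Valuations are rational numbers, so the exponents of \<pi> enter as integers
  \<open>m\<^sub>0\<close> and \<open>m\<close> whose rational images are the prescribed
  products.\<close>

theorem theorem2p10:
  fixes \<iota> :: "'p :: prime_card padic \<Rightarrow> 'k :: field_char_0"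
    and \<nu> :: "'k \<Rightarrow> rat extended"
    and p e :: nat and \<pi> x\<^sub>0 :: 'k and b\<^sub>0 :: rat and k\<^sub>0 :: int
  assumes "p = CARD('p)"
    and "finite_extension \<iota>"
    and "discrete_valuation \<nu>"
    and "\<And>a. \<nu> (\<iota> a) = padic_val a"
    and "is_uniformizer \<nu> \<pi>"
    and "is_ramification_index p \<nu> e"
    and "is_primitive_anti_partial_deriv p \<nu> (partial_deriv p \<nu> x\<^sub>0) x\<^sub>0"
    and "\<nu> x\<^sub>0 = Fin (b\<^sub>0 * of_nat p powi k\<^sub>0)"
    and "rat_val p b\<^sub>0 = 0"
    and "k\<^sub>0 > 0"
  shows "(\<exists>f. bij_betw f (C_set p b\<^sub>0 k\<^sub>0) (anti_partial_derivs p \<nu> (partial_deriv p \<nu> x\<^sub>0)))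
    \<and> (\<forall>\<alpha>\<^sub>0 \<in> integer_units \<nu>. \<forall>\<alpha>\<^sub>p \<in> integer_units \<nu>. \<forall>m\<^sub>0 :: int.
         of_int m\<^sub>0 = of_nat e * b\<^sub>0 * of_nat p powi k\<^sub>0 \<longrightarrow>
         x\<^sub>0 = \<alpha>\<^sub>0 * \<pi> powi m\<^sub>0 \<longrightarrow>
         of_nat p = \<alpha>\<^sub>p * \<pi> ^ e \<longrightarrow>
         (\<forall>x \<in> anti_partial_derivs p \<nu> (partial_deriv p \<nu> x\<^sub>0).
          \<forall>\<alpha> \<in> integer_units \<nu>. \<forall>(b :: rat) (k :: int) (m :: int).
            of_int m = of_nat e * b * of_nat p powi k \<longrightarrow>
            x = \<alpha> * \<pi> powi m \<longrightarrow>
            rat_val p b = 0 \<longrightarrow>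
            (\<exists>!c. c \<in> C_set p b\<^sub>0 k\<^sub>0
               \<and> k = int p ^ nat k\<^sub>0 * int c + k\<^sub>0 \<and> k \<ge> 0
               \<and> b = (b\<^sub>0 - of_nat c) / of_nat p powi (k - k\<^sub>0)
               \<and> b = (b\<^sub>0 - of_nat c) / of_nat p ^ (p ^ nat k\<^sub>0 * c)
               \<and> \<alpha> = \<alpha>\<^sub>0 * of_rat b\<^sub>0 / of_rat b * \<alpha>\<^sub>p powi (k\<^sub>0 - k)
               \<and> \<alpha>\<^sub>0 * of_rat b\<^sub>0 / of_rat b * \<alpha>\<^sub>p powi (k\<^sub>0 - k) \<in> integer_units \<nu>)))"
proof -
  interpret primitive_anti_partial_deriv p \<nu> x\<^sub>0 b\<^sub>0 k\<^sub>0
    by standard (use assms val_prime[OF assms(2,4)] prime_card[where ?'a = 'p] in auto)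
  have "\<exists>!c. c \<in> C_set p b\<^sub>0 k\<^sub>0
      \<and> k = int p ^ nat k\<^sub>0 * int c + k\<^sub>0 \<and> k \<ge> 0
      \<and> b = (b\<^sub>0 - of_nat c) / of_nat p powi (k - k\<^sub>0)
      \<and> b = (b\<^sub>0 - of_nat c) / of_nat p ^ (p ^ nat k\<^sub>0 * c)
      \<and> \<alpha> = \<alpha>\<^sub>0 * of_rat b\<^sub>0 / of_rat b * \<alpha>\<^sub>p powi (k\<^sub>0 - k)
      \<and> \<alpha>\<^sub>0 * of_rat b\<^sub>0 / of_rat b * \<alpha>\<^sub>p powi (k\<^sub>0 - k) \<in> integer_units \<nu>"
    if units: "\<alpha>\<^sub>0 \<in> integer_units \<nu>" "\<alpha>\<^sub>p \<in> integer_units \<nu>" "\<alpha> \<in> integer_units \<nu>"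
      and m0: "of_int m\<^sub>0 = of_nat e * b\<^sub>0 * of_nat p powi k\<^sub>0"
      and x0: "x\<^sub>0 = \<alpha>\<^sub>0 * \<pi> powi m\<^sub>0" and pp: "of_nat p = \<alpha>\<^sub>p * \<pi> ^ e"
      and x: "x \<in> antis" and m: "of_int m = of_nat e * b * of_nat p powi k"
      and x\<alpha>: "x = \<alpha> * \<pi> powi m" and b: "rat_val p b = 0"
    for \<alpha>\<^sub>0 \<alpha>\<^sub>p \<alpha> x :: 'k and m\<^sub>0 m k b
  proof -
    have m': "of_int m = of_nat e * (b * of_nat p powi k)" using m by (simp add: mult.assoc)
    \<comment> \<open>Supplies the valuation of x in the form needed by
      \<open>anti_parameter\<close>, and \<pi> \<noteq> 0 for the cancellation of
      \<open>\<pi> powi m\<close>.\<close>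
    note val = val_unit_times_powi[OF units(3,2) pp m']
    have b_nz: "b \<noteq> 0" using b by (simp add: rat_val_0_iff)
    obtain c where c: "c \<in> C_set p b\<^sub>0 k\<^sub>0" "k = int p ^ nat k\<^sub>0 * int c + k\<^sub>0"
      and bc: "b\<^sub>0 - of_nat c = b * of_nat p powi (k - k\<^sub>0)"
      and xc: "x = x\<^sub>0 * of_rat b\<^sub>0 / of_rat (b\<^sub>0 - of_nat c)"
      and diff: "b\<^sub>0 * of_nat p powi k\<^sub>0 - b * of_nat p powi k = of_int (k - k\<^sub>0)"
      using anti_parameter[OF x val(1)[folded x\<alpha>] b] by blast
    have powi: "of_nat p powi (k - k\<^sub>0) = (of_nat p ^ (p ^ nat k\<^sub>0 * c) :: rat)"
      using c(2) by (simp flip: power_int_of_nat)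
    \<comment> \<open>The exponents of \<pi> in \<open>x\<^sub>0\<close> and x differ by e times the
      difference of valuations, which is \<open>k - k\<^sub>0\<close>.\<close>
    have "rat_of_int (m\<^sub>0 - m) = of_nat e * (b\<^sub>0 * of_nat p powi k\<^sub>0 - b * of_nat p powi k)"
      by (simp add: m m0 algebra_simps)
    also have "\<dots> = of_int (int e * (k - k\<^sub>0))" by (simp add: diff)
    finally have mm: "m\<^sub>0 = m + int e * (k - k\<^sub>0)"
      unfolding of_int_eq_iff by simp
    have ppk: "of_nat p powi (k - k\<^sub>0) = \<alpha>\<^sub>p powi (k - k\<^sub>0) * \<pi> powi (int e * (k - k\<^sub>0))"
      by (simp add: pp power_int_mult_distrib power_int_mult)
    have "\<alpha> * \<pi> powi m = \<alpha>\<^sub>0 * \<pi> powi m\<^sub>0 * of_rat b\<^sub>0 / (of_rat b * of_nat p powi (k - k\<^sub>0))"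
      using xc unfolding x\<alpha> x0 bc by (simp add: of_rat_mult of_rat_powi)
    \<comment> \<open>The powers of \<pi> in \<open>ppk\<close> cancel the excess of
      \<open>m\<^sub>0\<close> over m, so only the power of \<open>\<alpha>\<^sub>p\<close>
      survives.\<close>
    also have "\<dots> = \<alpha>\<^sub>0 * of_rat b\<^sub>0 / of_rat b * \<alpha>\<^sub>p powi (k\<^sub>0 - k) * \<pi> powi m"
      using val(2) fval_unit(1)[OF units(2)] b_nz
      unfolding mm ppk by (simp add: power_int_add power_int_diff field_simps)
    finally have \<alpha>: "\<alpha> = \<alpha>\<^sub>0 * of_rat b\<^sub>0 / of_rat b * \<alpha>\<^sub>p powi (k\<^sub>0 - k)"
      by (rule mult_right_cancel[THEN iffD1, rotated]) (simp add: val(2))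
    have b_eq: "b = (b\<^sub>0 - of_nat c) / of_nat p powi (k - k\<^sub>0)" by (simp add: bc)
    have "k \<ge> 0" using c(2) k0_pos by simp
    \<comment> \<open>Uniqueness: k alone determines c, since the power of p is nonzero.\<close>
    moreover have "d = c" if "k = int p ^ nat k\<^sub>0 * int d + k\<^sub>0" for d
      using that c(2) by simp
    ultimately show ?thesis
      \<comment> \<open>The last conjunct holds because the expression equals \<alpha>, a unit by
        assumption.\<close>
      using c b_eq b_eq[unfolded powi] \<alpha> units(3)[unfolded \<alpha>] by blast
  qed
  then show ?thesis using bij_betw_C_set_antis by blast
qed

end
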